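(* Let $B=(B_t)_{t\ge 0}$ be a standard (real-valued) Brownian motion. Let $\varepsilon>0$ and define the random variable $$M_B := \sup_{\substack{0<s<t<\infty,\\ h=|t-s|}} \frac{|B_t-B_s|}{\sqrt{h\left(1+\ln\frac{t}{h}+\varepsilon|\ln t|\right)}}.$$ Then $M_B^2$ admits exponential moments, i.e. there exists $\lambda>0$ such that $\mathbb{E}\left[\exp(\lambda M_B^2)\right]<\infty$.
   Context: A nonnegative random variable $Z$ is said to admit exponential moments if $\mathbb{E}[\exp(\lambda Z)]<\infty$ for some $\lambda>0$. *)

theory Defs
  imports "HOL-Probability.Probability"
begin

(* The index type is real, but only times t >= 0 are constrained. *)
locale standard_brownian_motion = prob_space M
  for M :: "'a measure" and B :: "real \<Rightarrow> 'a \<Rightarrow> real" +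
  assumes random_variable: "\<And>t. 0 \<le> t \<Longrightarrow> B t \<in> borel_measurable M"
    and start_zero: "AE \<omega> in M. B 0 \<omega> = 0"
    and independent_increments:
      "\<And>(n::nat) \<tau> :: nat \<Rightarrow> real. 0 \<le> \<tau> 0 \<Longrightarrow> (\<And>i. i < n \<Longrightarrow> \<tau> i < \<tau> (Suc i)) \<Longrightarrow>
        indep_vars (\<lambda>_. borel) (\<lambda>i \<omega>. B (\<tau> (Suc i)) \<omega> - B (\<tau> i) \<omega>) {..<n}"
    and normal_increments:
      "\<And>s t. 0 \<le> s \<Longrightarrow> s < t \<Longrightarrow>
        distributed M lborel (\<lambda>\<omega>. B t \<omega> - B s \<omega>) (normal_density 0 (sqrt (t - s)))"
    and continuous_paths: "AE \<omega> in M. continuous_on {0..} (\<lambda>t. B t \<omega>)"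

(* The supremum is taken in [0,\<infinity>]: its finiteness is not part of the definition. *)
definition brownian_modulus :: "(real \<Rightarrow> 'a \<Rightarrow> real) \<Rightarrow> real \<Rightarrow> 'a \<Rightarrow> ennreal" where
  "brownian_modulus B \<epsilon> \<omega> =
    (SUP (s, t) \<in> {(s, t). 0 < s \<and> s < t}.
      let h = \<bar>t - s\<bar> in
        ennreal (\<bar>B t \<omega> - B s \<omega>\<bar> / sqrt (h * (1 + ln (t / h) + \<epsilon> * \<bar>ln t\<bar>))))"

definition ennreal_exp :: "ennreal \<Rightarrow> ennreal" where
  "ennreal_exp x = (if x = \<infinity> then \<infinity> else ennreal (exp (enn2real x)))"

definition admits_exponential_moments :: "'a measure \<Rightarrow> ('a \<Rightarrow> ennreal) \<Rightarrow> bool" where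
  "admits_exponential_moments M Z \<longleftrightarrow>
    Z \<in> borel_measurable M \<and>
    (\<exists>l::real. l > 0 \<and> (\<integral>\<^sup>+ \<omega>. ennreal_exp (ennreal l * Z \<omega>) \<partial>M) < \<infinity>)"

end

theory Submission imports Defs
begin

text \<open>
  Every normalised increment \<open>N\<close> of \<open>B\<close> over a dyadic subinterval of level \<open>m\<close> of \<open>[0, 2 ^ a / 2 ^ b]\<close> satisfies
  \<open>E (exp (N\<^sup>2 / 4)) = sqrt 2\<close>. Weighting these exponentials by \<open>exp (- 2 m - \<epsilon> (a + b))\<close> and summing over
  all \<open>a\<close>, \<open>b\<close>, \<open>m\<close> and all \<open>2 ^ m\<close> subintervals gives a random variable \<open>S\<close> of finite mean. Since each summand
  is at most \<open>S\<close>, all dyadic increments obey \<open>N\<^sup>2 \<le> 4 (ln S + 2 m + \<epsilon> (a + b))\<close> simultaneously, and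
  chaining along dyadic approximations turns this into \<open>M\<^sub>B\<^sup>2 \<le> C max 1 (ln S)\<close> with a constant \<open>C\<close>.
  Hence \<open>exp (M\<^sub>B\<^sup>2 / C) \<le> exp 1 + S\<close> is integrable.
\<close>

section \<open>Chaining along dyadic points of the unit interval\<close>

lemma ex_dyadic_bracket:
  fixes x :: real
  assumes "1 \<le> x"
  obtains p :: nat where "2 ^ p \<le> x" "x < 2 ^ Suc p"
proof
  define p where "p = nat \<lfloor>log 2 x\<rfloor>"
  have p: "real p = of_int \<lfloor>log 2 x\<rfloor>" using assms by (simp add: p_def)
  have "2 powr real p \<le> x" using assms p by (simp add: powr_le_iff)
  then show "2 ^ p \<le> x" by (simp add: powr_realpow)
  have "log 2 x < real (Suc p)" using p by simp linarith
  then have "x < 2 powr real (Suc p)" using assms by (simp add: log_less_iff)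
  then show "x < 2 ^ Suc p" by (simp add: powr_realpow del: of_nat_Suc power_Suc)
qed

text \<open>The truncations of \<open>z\<close> to \<open>m\<close> binary places converge to
  \<open>z\<close>. Each refinement stays put or moves right by one interval of the next level, and
  the geometric decay of \<open>c\<close> keeps the sum of these moves comparable to
  \<open>c p\<close>.\<close>

lemma dyadic_chaining_approx:
  fixes g :: "real \<Rightarrow> real" and c :: "nat \<Rightarrow> real"
  assumes cont: "continuous_on {0..1} g"
    and inc: "\<And>m j. j < 2 ^ m \<Longrightarrow> \<bar>g ((real j + 1) / 2 ^ m) - g (real j / 2 ^ m)\<bar> \<le> c m"
    and ratio: "\<And>m. c (Suc m) \<le> 5 / 6 * c m"
    and z: "0 \<le> z" "z \<le> 1"
  shows "\<bar>g z - g (real (nat \<lfloor>2 ^ p * z\<rfloor>) / 2 ^ p)\<bar> \<le> 6 * c p"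
proof -
  define j where "j m = nat \<lfloor>2 ^ m * z\<rfloor>" for m
  define d where "d m = real (j m) / 2 ^ m" for m
  have j_le: "real (j m) \<le> 2 ^ m * z" and j_gt: "2 ^ m * z < real (j m) + 1" for m
    using z by (simp_all add: j_def)
  have c_nonneg: "0 \<le> c m" for m
    using inc[of 0 m] by auto
  have step: "\<bar>g (d (Suc m)) - g (d m)\<bar> \<le> c (Suc m)" for m
  proof -
    have "real (j (Suc m)) < real (2 * j m + 2)" "real (2 * j m) < real (j (Suc m) + 1)"
      using j_le[of "Suc m"] j_gt[of "Suc m"] j_le[of m] j_gt[of m] by simp_all
    then have "j (Suc m) < 2 * j m + 2" "2 * j m < j (Suc m) + 1"
      by (simp_all only: of_nat_less_iff)
    then consider "j (Suc m) = 2 * j m" | "j (Suc m) = 2 * j m + 1" by linarith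
    then show ?thesis
    proof cases
      case 1
      then show ?thesis using c_nonneg by (simp add: d_def)
    next
      case 2
      \<comment> \<open>Since \<open>z \<le> 1\<close>, the interval of level \<open>Suc m\<close>
        with left index \<open>2 * j m\<close> lies in the unit interval, as \<open>inc\<close>
        requires.\<close>
      have "2 ^ Suc m * z \<le> 2 ^ Suc m" by (rule mult_left_le) (use z in auto)
      then have "real (2 * j m + 1) \<le> real (2 ^ Suc m)"
        using order_trans[OF j_le[of "Suc m"]] 2 by simp
      then have "2 * j m + 1 \<le> 2 ^ Suc m" by (simp only: of_nat_le_iff)
      then have "\<bar>g ((real (2 * j m) + 1) / 2 ^ Suc m) - g (real (2 * j m) / 2 ^ Suc m)\<bar> \<le> c (Suc m)"
        by (intro inc) simp
      then show ?thesis using 2 by (simp add: d_def add.commute)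
    qed
  qed
  \<comment> \<open>\<open>6 * c\<close> acts as a potential:
    \<open>7 * c (Suc m) \<le> 35 / 6 * c m \<le> 6 * c m\<close>, so the drop of
    \<open>6 * c\<close> pays for each step.\<close>
  have bound: "\<bar>g (d (k + p)) - g (d p)\<bar> \<le> 6 * c p - 6 * c (k + p)" for k
  proof (induction k)
    case (Suc k)
    then show ?case using step[of "k + p"] ratio[of "k + p"] c_nonneg[of "k + p"] by simp
  qed simp
  have "d \<longlonglongrightarrow> z"
  proof (rule tendsto_sandwich)
    show "(\<lambda>m. z - (1 / 2) ^ m) \<longlonglongrightarrow> z"
      by (rule tendsto_eq_intros LIMSEQ_realpow_zero refl | simp)+
    show "\<forall>\<^sub>F m in sequentially. z - (1 / 2) ^ m \<le> d m"
    proof (intro always_eventually allI)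
      fix m
      have "z - (1 / 2) ^ m = (2 ^ m * z - 1) / 2 ^ m" by (simp add: field_simps)
      also have "\<dots> \<le> d m"
        unfolding d_def using j_gt[of m] by (intro divide_right_mono) auto
      finally show "z - (1 / 2) ^ m \<le> d m" .
    qed
    show "\<forall>\<^sub>F m in sequentially. d m \<le> z"
      using j_le by (auto simp: d_def field_simps intro!: always_eventually)
  qed simp
  moreover have "d m \<in> {0..1}" for m
  proof -
    have "d m \<le> z" using j_le[of m] by (simp add: d_def field_simps)
    moreover have "0 \<le> d m" by (simp add: d_def)
    ultimately show ?thesis using z by simp
  qed
  ultimately have "(\<lambda>m. g (d m)) \<longlonglongrightarrow> g z"
    using z by (intro continuous_on_tendsto_compose[OF cont]) (auto intro: always_eventually)
  then have "(\<lambda>k. \<bar>g (d (k + p)) - g (d p)\<bar>) \<longlonglongrightarrow> \<bar>g z - g (d p)\<bar>"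
    by (intro tendsto_intros LIMSEQ_ignore_initial_segment)
  moreover have "\<bar>g (d (k + p)) - g (d p)\<bar> \<le> 6 * c p" for k
    using bound[of k] c_nonneg[of "k + p"] by simp
  ultimately show ?thesis
    unfolding d_def j_def by (intro LIMSEQ_le_const2) auto
qed

text \<open>Truncated at level \<open>p\<close>, points at most \<open>1 / 2 ^ p\<close> apart
  coincide or become neighbours. The constant is 6 + 1 + 6: one approximation error at each end and
  at most one increment between.\<close>

lemma dyadic_chaining:
  fixes g :: "real \<Rightarrow> real" and c :: "nat \<Rightarrow> real"
  assumes cont: "continuous_on {0..1} g"
    and inc: "\<And>m j. j < 2 ^ m \<Longrightarrow> \<bar>g ((real j + 1) / 2 ^ m) - g (real j / 2 ^ m)\<bar> \<le> c m"
    and ratio: "\<And>m. c (Suc m) \<le> 5 / 6 * c m"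
    and xy: "0 \<le> x" "x \<le> y" "y \<le> 1" "2 ^ p * (y - x) \<le> 1"
  shows "\<bar>g y - g x\<bar> \<le> 13 * c p"
proof -
  define i where "i = nat \<lfloor>2 ^ p * x\<rfloor>"
  define j where "j = nat \<lfloor>2 ^ p * y\<rfloor>"
  have i: "real i \<le> 2 ^ p * x" "2 ^ p * x < real i + 1"
    using xy by (simp_all add: i_def)
  have j: "real j \<le> 2 ^ p * y" "2 ^ p * y < real j + 1"
    using xy by (simp_all add: j_def)
  have xy': "2 ^ p * y \<le> 2 ^ p * x + 1" "2 ^ p * x \<le> 2 ^ p * y" "2 ^ p * y \<le> 2 ^ p"
    using xy by (simp_all add: algebra_simps)
  have "real j < real (i + 2)" "real i < real (j + 1)" "real j \<le> real (2 ^ p)"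
    unfolding of_nat_add of_nat_power of_nat_1 of_nat_numeral using i j xy' by linarith+
  then have ij: "j < i + 2" "i < j + 1" "j \<le> 2 ^ p"
    by (simp_all only: of_nat_less_iff of_nat_le_iff)
  have "0 \<le> c p" using inc[of 0 p] by auto
  then have "\<bar>g (real j / 2 ^ p) - g (real i / 2 ^ p)\<bar> \<le> c p"
    using inc[of i p] ij by (cases "j = i") (auto simp: add.commute dest: le_less_Suc_eq
      intro: subst[of "i + 1" j])
  moreover have "\<bar>g y - g (real j / 2 ^ p)\<bar> \<le> 6 * c p" "\<bar>g x - g (real i / 2 ^ p)\<bar> \<le> 6 * c p"
    unfolding i_def j_def using xy
    by (intro dyadic_chaining_approx[OF cont inc ratio]; simp)+
  ultimately show ?thesis by linarith
qed

section \<open>Dyadic time scales and the modulus of a single path\<close>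

lemma half_le_ln_two: "1 / 2 \<le> ln (2::real)"
  using ln_ge_iff[of 2 "1/2"] exp_bound_half[of "1/2::real"] by simp

text \<open>At most one exponent is chosen nonzero: \<open>a\<close> for \<open>t \<ge> 1\<close>,
  \<open>b\<close> for \<open>t < 1\<close>. As \<open>ln 2 \<ge> 1 / 2\<close>, the number of
  doublings or halvings is at most \<open>2 * \<bar>ln t\<bar>\<close>, plus 1 for rounding up when
  \<open>t \<ge> 1\<close>.\<close>

lemma ex_dyadic_scale:
  fixes t :: real
  assumes "0 < t"
  obtains a b :: nat where "t \<le> 2 ^ a / 2 ^ b" "2 ^ a / 2 ^ b \<le> 2 * t"
    "real a + real b \<le> 1 + 2 * \<bar>ln t\<bar>"
proof (cases "1 \<le> t")
  case True
  then obtain q where q: "2 ^ q \<le> t" "t < 2 ^ Suc q" by (rule ex_dyadic_bracket)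
  have "real q * ln 2 \<le> ln t"
    using q(1) True by (simp flip: ln_realpow)
  then have "real q \<le> 2 * ln t"
    using mult_left_mono[OF half_le_ln_two, of "real q"] by simp
  then show thesis
    using that[of "Suc q" 0] q True by simp
next
  case False
  then have "1 \<le> 1 / t" using assms by simp
  then obtain q where q: "2 ^ q \<le> 1 / t" "1 / t < 2 ^ Suc q" by (rule ex_dyadic_bracket)
  have "real q * ln 2 \<le> ln (1 / t)"
    using q(1) assms by (simp flip: ln_realpow del: ln_divide_pos ln_div)
  then have "real q \<le> 2 * ln (1 / t)"
    using mult_left_mono[OF half_le_ln_two, of "real q"] by linarith
  moreover have "ln (1 / t) = \<bar>ln t\<bar>" using False assms by (simp add: ln_div)
  ultimately show thesis
    using that[of 0 q] q assms by (simp add: field_simps)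
qed

text \<open>Chaining is applied to \<open>f\<close> on \<open>[0, T]\<close>, rescaled to the unit
  interval, for a power of two \<open>T\<close> between \<open>t\<close> and \<open>2 * t\<close>.
  The chaining level produces the term in \<open>ln (t / (t - s))\<close>, and the weight of
  \<open>(a, b)\<close> produces the term in \<open>\<bar>ln t\<bar>\<close>.\<close>

lemma path_modulus_bound:
  fixes f :: "real \<Rightarrow> real"
  assumes cont: "continuous_on {0..} f" and "1 \<le> L" "0 < \<epsilon>"
    and inc: "\<And>a b m j. j < 2 ^ m \<Longrightarrow>
      (f (2 ^ a / 2 ^ b * ((real j + 1) / 2 ^ m)) - f (2 ^ a / 2 ^ b * (real j / 2 ^ m)))\<^sup>2
        \<le> 2 ^ a / 2 ^ b / 2 ^ m * (4 * (L + 2 * real m + \<epsilon> * (real a + real b)))"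
    and st: "0 < s" "s < t"
  shows "(f t - f s)\<^sup>2 \<le> 1352 * (8 + \<epsilon>) * L * ((t - s) * (1 + ln (t / (t - s)) + \<epsilon> * \<bar>ln t\<bar>))"
proof -
  obtain a b :: nat where ab: "t \<le> 2 ^ a / 2 ^ b" "2 ^ a / 2 ^ b \<le> 2 * t"
    "real a + real b \<le> 1 + 2 * \<bar>ln t\<bar>"
    using st ex_dyadic_scale[of t] by auto
  define T :: real where "T = 2 ^ a / 2 ^ b"
  define E where "E = \<epsilon> * (real a + real b)"
  \<comment> \<open>The offset 6 makes \<open>c\<close> decay geometrically with ratio \<open>5 / 6\<close> even for \<open>m = E = 0\<close>.\<close>
  define c where "c m = sqrt (T / 2 ^ m * (4 * L * (6 + 2 * real m + E)))" for m
  have T: "0 < T" "t \<le> T" "T \<le> 2 * t" using ab by (simp_all add: T_def)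
  have E: "0 \<le> E" "E \<le> \<epsilon> + 2 * (\<epsilon> * \<bar>ln t\<bar>)"
    using ab mult_left_mono[OF ab(3), of \<epsilon>] \<open>0 < \<epsilon>\<close> by (simp_all add: E_def algebra_simps)
  define h where "h = t - s"
  have h: "0 < h" "h < t" using st by (simp_all add: h_def)
  have "1 \<le> T / h" using h T by simp
  \<comment> \<open>This level satisfies \<open>h \<le> T / 2 ^ p < 2 * h\<close>: the first
    inequality is the hypothesis of chaining, the second turns the level-\<open>p\<close> scale back
    into \<open>h\<close>.\<close>
  then obtain p where p: "2 ^ p \<le> T / h" "T / h < 2 ^ Suc p" by (rule ex_dyadic_bracket)
  have lnth: "0 \<le> ln (t / h)" using h by simp
  have "\<bar>f (T * (t / T)) - f (T * (s / T))\<bar> \<le> 13 * c p"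
  proof (rule dyadic_chaining[where g = "\<lambda>x. f (T * x)"])
    show "continuous_on {0..1} (\<lambda>x. f (T * x))"
      using T by (intro continuous_on_compose2[OF cont]) (auto intro!: continuous_intros)
    show "\<bar>f (T * ((real j + 1) / 2 ^ m)) - f (T * (real j / 2 ^ m))\<bar> \<le> c m" if "j < 2 ^ m" for m j
    proof -
      \<comment> \<open>\<open>L \<ge> 1\<close> lets \<open>L\<close> be pulled out as a factor, so
        that the final bound is linear in \<open>L\<close>.\<close>
      have "L + 2 * real m + E \<le> L * (6 + 2 * real m + E)"
        using mult_right_mono[OF \<open>1 \<le> L\<close>, of "6 + 2 * real m + E"]
          mult_right_mono[OF \<open>1 \<le> L\<close>, of "2 * real m + E"] \<open>1 \<le> L\<close> E
        by (simp add: algebra_simps)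
      then have "T / 2 ^ m * (4 * (L + 2 * real m + E)) \<le> T / 2 ^ m * (4 * L * (6 + 2 * real m + E))"
        using T by (intro mult_left_mono) auto
      then have "(f (T * ((real j + 1) / 2 ^ m)) - f (T * (real j / 2 ^ m)))\<^sup>2
          \<le> T / 2 ^ m * (4 * L * (6 + 2 * real m + E))"
        using inc[OF that, of a b] unfolding T_def E_def by linarith
      then show ?thesis
        unfolding c_def by (metis real_sqrt_abs real_sqrt_le_mono)
    qed
    show "c (Suc m) \<le> 5 / 6 * c m" for m
    proof -
      have *: "5 / 6 * c m = sqrt ((5 / 6)\<^sup>2 * (T / 2 ^ m * (4 * L * (6 + 2 * real m + E))))"
        unfolding c_def by (simp only: real_sqrt_mult real_sqrt_abs)
      have "T / 2 ^ Suc m * (4 * L * (6 + 2 * real (Suc m) + E))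
          = T / 2 ^ m * (4 * L) * (1 / 2 * (8 + 2 * real m + E))"
        by (simp add: field_simps)
      \<comment> \<open>With \<open>x = 2 * real m + E\<close> this amounts to
        \<open>18 * (8 + x) \<le> 25 * (6 + x)\<close>, that is, 144 against 150 at
        \<open>x = 0\<close>.\<close>
      also have "\<dots> \<le> T / 2 ^ m * (4 * L) * (25 / 36 * (6 + 2 * real m + E))"
        using T E \<open>1 \<le> L\<close> by (intro mult_left_mono) auto
      also have "\<dots> = (5 / 6)\<^sup>2 * (T / 2 ^ m * (4 * L * (6 + 2 * real m + E)))"
        by (simp add: power2_eq_square)
      finally show ?thesis unfolding * unfolding c_def by (rule real_sqrt_le_mono)
    qed
    have "t / T - s / T = h / T" by (simp add: h_def diff_divide_distrib)
    then show "2 ^ p * (t / T - s / T) \<le> 1"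
      using p(1) h T by (simp add: field_simps)
  qed (use st T in \<open>auto simp: divide_right_mono\<close>)
  then have "\<bar>f t - f s\<bar> \<le> 13 * c p" using T by simp
  then have "(f t - f s)\<^sup>2 \<le> (13 * c p)\<^sup>2"
    by (metis abs_le_square_iff abs_ge_zero abs_of_nonneg order_trans)
  also have "\<dots> = 169 * (T / 2 ^ p * (4 * L * (6 + 2 * real p + E)))"
    using T E \<open>1 \<le> L\<close> by (simp add: c_def power_mult_distrib)
  \<comment> \<open>The factor 1352 is \<open>169 * 2 * 4\<close>. The coefficient
    \<open>8 + \<epsilon>\<close> dominates all those arising from
    \<open>p \<le> 1 + 2 * ln (t / h)\<close> and the bound on \<open>E\<close>.\<close>
  also have "\<dots> \<le> 169 * ((2 * h) * (4 * L * ((8 + \<epsilon>) * (1 + ln (t / h) + \<epsilon> * \<bar>ln t\<bar>))))"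
  proof (intro mult_left_mono mult_mono)
    show "T / 2 ^ p \<le> 2 * h" using p(2) h by (simp add: field_simps)
    have "real p * ln 2 \<le> ln (T / h)"
      using p(1) T h by (simp flip: ln_realpow del: ln_divide_pos ln_div)
    also have "\<dots> \<le> ln (2 * (t / h))"
      using T h by (simp add: divide_right_mono del: ln_divide_pos ln_div)
    also have "\<dots> = ln 2 + ln (t / h)"
      using h by (intro ln_mult_pos) auto
    finally have "(real p - 1) * ln 2 \<le> ln (t / h)" by (simp add: algebra_simps)
    \<comment> \<open>For \<open>p = 0\<close> the factor \<open>p - 1\<close> is negative and
      reverses the comparison; there the bound on \<open>p\<close> follows from \<open>lnth\<close>
      alone.\<close>
    moreover have "(real p - 1) * (1 / 2) \<le> (real p - 1) * ln 2" if "1 \<le> p"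
      using that half_le_ln_two by (intro mult_left_mono) auto
    ultimately have "real p \<le> 1 + 2 * ln (t / h)" using lnth by (cases "p = 0") auto
    then have "6 + 2 * real p + E \<le> 8 + 4 * ln (t / h) + \<epsilon> + 2 * (\<epsilon> * \<bar>ln t\<bar>)"
      using E by linarith
    also have "\<dots> \<le> (8 + \<epsilon>) + (8 + \<epsilon>) * ln (t / h) + (8 + \<epsilon>) * (\<epsilon> * \<bar>ln t\<bar>)"
    proof -
      have "4 * ln (t / h) \<le> (8 + \<epsilon>) * ln (t / h)"
        using lnth \<open>0 < \<epsilon>\<close> by (intro mult_right_mono) auto
      moreover have "2 * (\<epsilon> * \<bar>ln t\<bar>) \<le> (8 + \<epsilon>) * (\<epsilon> * \<bar>ln t\<bar>)"
        using \<open>0 < \<epsilon>\<close> by (intro mult_right_mono) auto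
      ultimately show ?thesis by linarith
    qed
    also have "\<dots> = (8 + \<epsilon>) * (1 + ln (t / h) + \<epsilon> * \<bar>ln t\<bar>)" by (simp add: algebra_simps)
    finally show "6 + 2 * real p + E \<le> (8 + \<epsilon>) * (1 + ln (t / h) + \<epsilon> * \<bar>ln t\<bar>)" .
  qed (use h T E \<open>1 \<le> L\<close> in auto)
  also have "\<dots> = 1352 * (8 + \<epsilon>) * L * (h * (1 + ln (t / h) + \<epsilon> * \<bar>ln t\<bar>))" by simp
  finally show ?thesis by (simp only: h_def)
qed

section \<open>Gaussian exponential moments and the dyadic energy\<close>

lemma nn_integral_exp_normal_square:
  fixes \<sigma> :: real
  assumes "0 < \<sigma>"
  shows "(\<integral>\<^sup>+x. ennreal (normal_density 0 \<sigma> x) * ennreal (exp (x\<^sup>2 / (4 * \<sigma>\<^sup>2))) \<partial>lborel) = ennreal (sqrt 2)"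
proof -
  \<comment> \<open>The exponential weight halves the exponent, which doubles the variance;
    comparing normalising constants leaves the factor \<open>sqrt 2\<close>.\<close>
  have "normal_density 0 \<sigma> x * exp (x\<^sup>2 / (4 * \<sigma>\<^sup>2)) = sqrt 2 * normal_density 0 (sqrt 2 * \<sigma>) x" for x
  proof -
    have "- x\<^sup>2 / (2 * \<sigma>\<^sup>2) + x\<^sup>2 / (4 * \<sigma>\<^sup>2) = - x\<^sup>2 / (4 * \<sigma>\<^sup>2)"
      using assms by (simp add: field_simps)
    then show ?thesis
      using assms
      by (simp add: normal_density_def power_mult_distrib real_sqrt_mult flip: exp_add) (simp add: field_simps)
  qed
  then have "(\<integral>\<^sup>+x. ennreal (normal_density 0 \<sigma> x) * ennreal (exp (x\<^sup>2 / (4 * \<sigma>\<^sup>2))) \<partial>lborel)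
      = (\<integral>\<^sup>+x. ennreal (sqrt 2) * ennreal (normal_density 0 (sqrt 2 * \<sigma>) x) \<partial>lborel)"
    by (simp flip: ennreal_mult')
  also have "\<dots> = ennreal (sqrt 2) * (\<integral>\<^sup>+x. ennreal (normal_density 0 (sqrt 2 * \<sigma>) x) \<partial>lborel)"
    by (simp add: nn_integral_cmult)
  also have "(\<integral>\<^sup>+x. ennreal (normal_density 0 (sqrt 2 * \<sigma>) x) \<partial>lborel) = 1"
    using assms by (simp add: nn_integral_eq_integral)
  finally show ?thesis by simp
qed

lemma suminf_exp_decay:
  fixes c :: real
  assumes "0 < c"
  shows "(\<Sum>n. ennreal (exp (- c * real n))) = ennreal (1 / (1 - exp (- c)))"
proof -
  have pow: "(\<lambda>n. exp (- c * real n)) = (\<lambda>n. exp (- c) ^ n)"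
    by (simp add: exp_of_nat_mult[symmetric] mult.commute)
  have "(\<lambda>n. exp (- c * real n)) sums (1 / (1 - exp (- c)))"
    unfolding pow using assms by (intro geometric_sums) simp
  then show ?thesis by (intro suminf_ennreal_eq) simp
qed

definition dyadic_increment :: "(real \<Rightarrow> 'a \<Rightarrow> real) \<Rightarrow> nat \<Rightarrow> nat \<Rightarrow> nat \<Rightarrow> nat \<Rightarrow> 'a \<Rightarrow> real" where
  "dyadic_increment B a b m j \<omega> =
    B (2 ^ a / 2 ^ b * ((real j + 1) / 2 ^ m)) \<omega> - B (2 ^ a / 2 ^ b * (real j / 2 ^ m)) \<omega>"

text \<open>The pairs \<open>(a, b)\<close> encode all integer powers of 2 redundantly; only those with \<open>a = 0\<close> or \<open>b = 0\<close>
  are used, and for them \<open>a + b\<close> is comparable to \<open>\<bar>ln t\<bar>\<close>.\<close>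

definition dyadic_energy :: "(real \<Rightarrow> 'a \<Rightarrow> real) \<Rightarrow> real \<Rightarrow> 'a \<Rightarrow> ennreal" where
  "dyadic_energy B \<epsilon> \<omega> =
    (\<Sum>a. \<Sum>b. \<Sum>m. \<Sum>j<2 ^ m. ennreal (exp (- \<epsilon> * real a)) * (ennreal (exp (- \<epsilon> * real b)) *
      (ennreal (exp (- 2 * real m)) *
        ennreal (exp ((dyadic_increment B a b m j \<omega>)\<^sup>2 / (4 * (2 ^ a / 2 ^ b / 2 ^ m)))))))"

lemma dyadic_energy_ge:
  assumes "j < 2 ^ m"
  shows "ennreal (exp (- \<epsilon> * real a)) * (ennreal (exp (- \<epsilon> * real b)) * (ennreal (exp (- 2 * real m)) *
      ennreal (exp ((dyadic_increment B a b m j \<omega>)\<^sup>2 / (4 * (2 ^ a / 2 ^ b / 2 ^ m))))))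
    \<le> dyadic_energy B \<epsilon> \<omega>"
proof -
  have le_suminf: "f n \<le> suminf f" for f :: "nat \<Rightarrow> ennreal" and n
    using sum_le_suminf[of f "{n}"] by simp
  show ?thesis
    unfolding dyadic_energy_def
    by (rule order_trans[OF _ le_suminf[of _ a]], rule order_trans[OF _ le_suminf[of _ b]],
        rule order_trans[OF _ le_suminf[of _ m]], rule member_le_sum) (use assms in auto)
qed

text \<open>All terms of the energy are nonnegative, so each one is at most \<open>exp L\<close>;
  taking logarithms turns the weights into additive terms.\<close>

lemma dyadic_increment_bound:
  assumes "j < 2 ^ m" and "dyadic_energy B \<epsilon> \<omega> \<le> ennreal (exp L)"
  shows "(dyadic_increment B a b m j \<omega>)\<^sup>2
    \<le> 2 ^ a / 2 ^ b / 2 ^ m * (4 * (L + 2 * real m + \<epsilon> * (real a + real b)))"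
proof -
  let ?q = "2 ^ a / 2 ^ b / 2 ^ m :: real"
  have "ennreal (exp (- \<epsilon> * real a + (- \<epsilon> * real b +
      (- 2 * real m + (dyadic_increment B a b m j \<omega>)\<^sup>2 / (4 * ?q))))) \<le> ennreal (exp L)"
    unfolding exp_add ennreal_mult'[OF exp_ge_zero]
    by (rule order_trans[OF dyadic_energy_ge[OF assms(1)] assms(2)])
  then have "(dyadic_increment B a b m j \<omega>)\<^sup>2 / (4 * ?q) \<le> L + 2 * real m + \<epsilon> * (real a + real b)"
    by (simp add: algebra_simps)
  moreover have "0 < 4 * ?q" by simp
  ultimately have "(dyadic_increment B a b m j \<omega>)\<^sup>2 \<le> (L + 2 * real m + \<epsilon> * (real a + real b)) * (4 * ?q)"
    by (simp only: pos_divide_le_eq)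
  then show ?thesis by (simp only: mult_ac)
qed

section \<open>From the energy to the Brownian modulus\<close>

lemma brownian_modulus_bound:
  assumes "continuous_on {0..} (\<lambda>t. B t \<omega>)" "0 < \<epsilon>" "1 \<le> L"
    and "dyadic_energy B \<epsilon> \<omega> \<le> ennreal (exp L)"
  shows "(brownian_modulus B \<epsilon> \<omega>)\<^sup>2 \<le> ennreal (1352 * (8 + \<epsilon>) * L)"
proof -
  let ?\<Gamma> = "1352 * (8 + \<epsilon>) * L"
  have "brownian_modulus B \<epsilon> \<omega> \<le> ennreal (sqrt ?\<Gamma>)"
    unfolding brownian_modulus_def
  proof (rule SUP_least, clarify)
    fix s t :: real
    assume st: "0 < s" "s < t"
    let ?D = "1 + ln (t / (t - s)) + \<epsilon> * \<bar>ln t\<bar>"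
    have "0 \<le> ln (t / (t - s))" using st by simp
    then have D: "0 < (t - s) * ?D" using st \<open>0 < \<epsilon>\<close> by (intro mult_pos_pos) (auto intro!: add_pos_nonneg)
    have "(B t \<omega> - B s \<omega>)\<^sup>2 \<le> ?\<Gamma> * ((t - s) * ?D)"
      using assms(1) \<open>1 \<le> L\<close> \<open>0 < \<epsilon>\<close> dyadic_increment_bound[OF _ assms(4), unfolded dyadic_increment_def] st
      by (rule path_modulus_bound)
    then have "\<bar>B t \<omega> - B s \<omega>\<bar> \<le> sqrt ?\<Gamma> * sqrt ((t - s) * ?D)"
      by (metis real_sqrt_abs real_sqrt_le_mono real_sqrt_mult)
    then have "\<bar>B t \<omega> - B s \<omega>\<bar> / sqrt ((t - s) * ?D) \<le> sqrt ?\<Gamma>"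
      using D by (simp only: pos_divide_le_eq real_sqrt_gt_0_iff)
    then show "(let h = \<bar>t - s\<bar> in
        ennreal (\<bar>B t \<omega> - B s \<omega>\<bar> / sqrt (h * (1 + ln (t / h) + \<epsilon> * \<bar>ln t\<bar>)))) \<le> ennreal (sqrt ?\<Gamma>)"
      using st by (simp add: Let_def ennreal_leI)
  qed
  then have "(brownian_modulus B \<epsilon> \<omega>)\<^sup>2 \<le> (ennreal (sqrt ?\<Gamma>))\<^sup>2"
    by (rule power_mono) simp
  also have "\<dots> = ennreal ?\<Gamma>"
    using \<open>1 \<le> L\<close> \<open>0 < \<epsilon>\<close> by (simp add: ennreal_power)
  finally show ?thesis .
qed

text \<open>For energy \<open>s\<close> take \<open>L = max 1 (ln s)\<close>. The factor
  \<open>1 / (1352 * (8 + \<epsilon>))\<close> cancels the constant of the modulus bound, leaving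
  \<open>exp L = max (exp 1) s\<close>. Infinite energy makes the right-hand side infinite.\<close>

lemma ennreal_exp_brownian_modulus_le:
  assumes "continuous_on {0..} (\<lambda>t. B t \<omega>)" "0 < \<epsilon>"
  shows "ennreal_exp (ennreal (1 / (1352 * (8 + \<epsilon>))) * (brownian_modulus B \<epsilon> \<omega>)\<^sup>2)
    \<le> ennreal (exp 1) + dyadic_energy B \<epsilon> \<omega>"
proof (cases "dyadic_energy B \<epsilon> \<omega>")
  case (real s)
  define L where "L = (if s \<le> exp 1 then 1 else ln s)"
  let ?\<Gamma> = "1352 * (8 + \<epsilon>)"
  let ?x = "ennreal (1 / ?\<Gamma>) * (brownian_modulus B \<epsilon> \<omega>)\<^sup>2"
  have s: "exp 1 < s \<Longrightarrow> 0 < s" using less_trans[OF exp_gt_zero] by blast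
  have L: "1 \<le> L" "s \<le> exp L" "exp L \<le> exp 1 + s"
    using real s by (auto simp: L_def ln_ge_iff)
  have "(brownian_modulus B \<epsilon> \<omega>)\<^sup>2 \<le> ennreal (?\<Gamma> * L)"
    using assms L real by (intro brownian_modulus_bound) (auto intro: ennreal_leI)
  then have "?x \<le> ennreal (1 / ?\<Gamma>) * ennreal (?\<Gamma> * L)"
    by (rule mult_left_mono) simp
  also have "\<dots> = ennreal L"
    using assms by (simp flip: ennreal_mult')
  finally have x: "?x \<le> ennreal L" .
  \<comment> \<open>Finiteness selects the real branch of \<open>ennreal_exp\<close>, where
    \<open>enn2real\<close> is faithful.\<close>
  then have "?x \<noteq> \<infinity>" by (auto simp: top_unique)
  moreover have "enn2real ?x \<le> L" using x L by (intro enn2real_leI) auto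
  ultimately have "ennreal_exp ?x \<le> ennreal (exp L)"
    by (simp add: ennreal_exp_def ennreal_leI)
  also have "\<dots> \<le> ennreal (exp 1 + s)" using L by (intro ennreal_leI)
  finally show ?thesis using real by simp
qed simp

section \<open>Measurability up to null sets and rational approximation\<close>

lemma measurable_completion_AE_eq:
  assumes f: "f \<in> M \<rightarrow>\<^sub>M N" and eq: "AE x in M. f x = g x"
    and g: "\<And>x. x \<in> space M \<Longrightarrow> g x \<in> space N"
  shows "g \<in> completion M \<rightarrow>\<^sub>M N"
proof (rule measurableI)
  fix A assume A: "A \<in> sets N"
  \<comment> \<open>The two preimages differ only on a null set, and the completion contains every
    set that agrees almost everywhere with a measurable one.\<close>
  have "AE x in completion M. x \<in> f -` A \<inter> space M \<longleftrightarrow> x \<in> g -` A \<inter> space M"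
    using AE_completion[OF eq] by eventually_elim auto
  moreover have "f -` A \<inter> space M \<in> sets (completion M)"
    by (intro sets_completionI_sets measurable_sets[OF f A])
  ultimately have "g -` A \<inter> space M \<in> sets (completion M)"
    by (rule completion.in_sets_AE) simp
  then show "g -` A \<inter> space (completion M) \<in> sets (completion M)" by simp
next
  fix x assume "x \<in> space (completion M)"
  then show "g x \<in> space N" by (intro g) simp
qed

text \<open>Approaching strictly from above keeps approximations of positive times positive.\<close>

lemma rational_sequence_above:
  fixes x :: real
  obtains u where "\<And>n. u n \<in> \<rat>" "\<And>n. x < u n" "u \<longlonglongrightarrow> x"
proof -
  have "\<exists>q\<in>\<rat>. x < q \<and> q < x + inverse (real (Suc n))" for n
    by (rule Rats_dense_in_real) simp
  then obtain u where u: "\<And>n. u n \<in> \<rat>" "\<And>n. x < u n" "\<And>n. u n < x + inverse (real (Suc n))"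
    by metis
  have "u \<longlonglongrightarrow> x"
  proof (rule tendsto_sandwich)
    show "\<forall>\<^sub>F n in sequentially. x \<le> u n" "\<forall>\<^sub>F n in sequentially. u n \<le> x + inverse (real (Suc n))"
      using u(2,3) by (blast intro: always_eventually less_imp_le)+
  qed (rule tendsto_const LIMSEQ_inverse_real_of_nat_add)+
  with u show thesis using that by blast
qed

section \<open>Mean energy and measurability of the modulus for Brownian motion\<close>

context standard_brownian_motion
begin

declare random_variable [measurable]

lemma dyadic_increment_measurable [measurable]:
  "dyadic_increment B a b m j \<in> borel_measurable M"
  unfolding dyadic_increment_def by measurable

lemma dyadic_energy_measurable [measurable]:
  "dyadic_energy B \<epsilon> \<in> borel_measurable M"
  unfolding dyadic_energy_def by measurable

text \<open>The interval length is the variance of the increment, so dividing by four times that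
  length gives the same moment at every scale.\<close>

lemma nn_integral_exp_increment_square:
  "(\<integral>\<^sup>+\<omega>. ennreal (exp ((dyadic_increment B a b m j \<omega>)\<^sup>2 / (4 * (2 ^ a / 2 ^ b / 2 ^ m)))) \<partial>M)
    = ennreal (sqrt 2)"
proof -
  let ?s = "2 ^ a / 2 ^ b * (real j / 2 ^ m) :: real"
  let ?t = "2 ^ a / 2 ^ b * ((real j + 1) / 2 ^ m) :: real"
  let ?q = "2 ^ a / 2 ^ b / 2 ^ m :: real"
  have "?t - ?s = ?q" by (simp add: field_simps)
  then have "distributed M lborel (dyadic_increment B a b m j) (normal_density 0 (sqrt ?q))"
    using normal_increments[of ?s ?t] unfolding dyadic_increment_def by (simp add: divide_strict_right_mono)
  from distributed_nn_integral[OF this, of "\<lambda>x. ennreal (exp (x\<^sup>2 / (4 * ?q)))"]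
  show ?thesis
    using nn_integral_exp_normal_square[of "sqrt ?q"] by simp
qed

text \<open>Every exponential has mean \<open>sqrt 2\<close>, so only the sum of the weights
  matters. It factorises into geometric series in \<open>a\<close>, \<open>b\<close> and
  \<open>m\<close>, once the \<open>2 ^ m\<close> intervals of each level have been
  absorbed.\<close>

lemma nn_integral_dyadic_energy:
  assumes "0 < \<epsilon>"
  shows "(\<integral>\<^sup>+\<omega>. dyadic_energy B \<epsilon> \<omega> \<partial>M) < \<infinity>"
proof -
  \<comment> \<open>The number of intervals \<open>2 ^ m\<close> is at most
    \<open>exp (real m)\<close>, so half of the decay \<open>exp (- 2 * real m)\<close>
    survives.\<close>
  have level: "(\<Sum>j::nat<2 ^ m. ennreal (exp (- 2 * real m)) * x) \<le> ennreal (exp (- 1 * real m)) * x" for m :: nat and x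
  proof -
    have "(2::real) ^ m \<le> exp 1 ^ m" using exp_ge_add_one_self[of 1] by (intro power_mono) auto
    then have "2 ^ m * exp (- 2 * real m) \<le> exp (real m) * exp (- 2 * real m)"
      by (intro mult_right_mono) (auto simp flip: exp_of_nat_mult)
    then have "2 ^ m * exp (- 2 * real m) \<le> exp (- 1 * real m)"
      by (simp flip: exp_add)
    then have "ennreal (2 ^ m * exp (- 2 * real m)) * x \<le> ennreal (exp (- 1 * real m)) * x"
      by (intro mult_right_mono ennreal_leI) auto
    then show ?thesis by (simp add: ennreal_mult mult.assoc flip: ennreal_power)
  qed
  define X where "X a b m j \<omega> =
    ennreal (exp ((dyadic_increment B a b m j \<omega>)\<^sup>2 / (4 * (2 ^ a / 2 ^ b / 2 ^ m))))" for a b m j \<omega>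
  have [measurable]: "X a b m j \<in> borel_measurable M" for a b m j
    unfolding X_def by measurable
  have X: "(\<integral>\<^sup>+\<omega>. X a b m j \<omega> \<partial>M) = ennreal (sqrt 2)" for a b m j
    unfolding X_def by (rule nn_integral_exp_increment_square)
  have "(\<integral>\<^sup>+\<omega>. dyadic_energy B \<epsilon> \<omega> \<partial>M) =
    (\<Sum>a. \<Sum>b. \<Sum>m. \<Sum>j<(2::nat) ^ m. ennreal (exp (- \<epsilon> * real a)) * (ennreal (exp (- \<epsilon> * real b)) *
      (ennreal (exp (- 2 * real m)) * ennreal (sqrt 2))))"
    unfolding dyadic_energy_def X_def[symmetric]
    by (simp add: nn_integral_suminf nn_integral_sum nn_integral_cmult X del: sum_constant)
  also have "\<dots> = (\<Sum>a. ennreal (exp (- \<epsilon> * real a))) * ((\<Sum>b. ennreal (exp (- \<epsilon> * real b))) *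
      (\<Sum>m. \<Sum>j<(2::nat) ^ m. ennreal (exp (- 2 * real m)) * ennreal (sqrt 2)))"
    by (simp only: sum_distrib_left[symmetric] ennreal_suminf_cmult ennreal_suminf_multc)
  also have "\<dots> \<le> (\<Sum>a. ennreal (exp (- \<epsilon> * real a))) * ((\<Sum>b. ennreal (exp (- \<epsilon> * real b))) *
      (\<Sum>m. ennreal (exp (- 1 * real m)) * ennreal (sqrt 2)))"
    by (intro mult_left_mono suminf_le level) auto
  also have "\<dots> = ennreal (1 / (1 - exp (- \<epsilon>))) * (ennreal (1 / (1 - exp (- \<epsilon>))) *
      (ennreal (1 / (1 - exp (- 1))) * ennreal (sqrt 2)))"
    by (simp only: ennreal_suminf_multc suminf_exp_decay assms zero_less_one)
  also have "\<dots> < \<infinity>"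
    by (simp only: ennreal_mult_less_top ennreal_less_top infinity_ennreal_def simp_thms)
  finally show ?thesis .
qed

text \<open>Almost surely the supremum may be restricted to rational times, which makes it measurable.\<close>

lemma brownian_modulus_measurable:
  assumes "0 < \<epsilon>"
  shows "brownian_modulus B \<epsilon> \<in> borel_measurable (completion M)"
proof -
  define Q :: "(real \<times> real) set" where "Q = {(s, t). s \<in> \<rat> \<and> t \<in> \<rat> \<and> 0 < s \<and> s < t}"
  define r where "r \<omega> s t =
    \<bar>B t \<omega> - B s \<omega>\<bar> / sqrt (\<bar>t - s\<bar> * (1 + ln (t / \<bar>t - s\<bar>) + \<epsilon> * \<bar>ln t\<bar>))" for \<omega> s t
  define R where "R \<omega> = (SUP (s, t) \<in> Q. ennreal (r \<omega> s t))" for \<omega>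
  have "countable Q"
    by (rule countable_subset[of _ "\<rat> \<times> \<rat>"]) (auto simp: Q_def countable_rat)
  then have "R \<in> borel_measurable M"
    unfolding R_def r_def by (intro borel_measurable_SUP) (auto simp: Q_def)
  moreover have "AE \<omega> in M. R \<omega> = brownian_modulus B \<epsilon> \<omega>"
    using continuous_paths
  proof eventually_elim
    fix \<omega>
    assume cont: "continuous_on {0..} (\<lambda>t. B t \<omega>)"
    \<comment> \<open>On a continuous path the quotient at \<open>(s, t)\<close> is a limit of
      quotients at rational pairs, and upper bounds pass to the limit.\<close>
    have "ennreal (r \<omega> s t) \<le> R \<omega>" if st: "0 < s" "s < t" for s t
    proof -
      obtain u where u: "\<And>n. u n \<in> \<rat>" "\<And>n. s < u n" "u \<longlonglongrightarrow> s"
        using rational_sequence_above[of s] by auto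
      obtain v where v: "\<And>n. v n \<in> \<rat>" "\<And>n. t < v n" "v \<longlonglongrightarrow> t"
        using rational_sequence_above[of t] by auto
      have B_lim: "(\<lambda>n. B (w n) \<omega>) \<longlonglongrightarrow> B x \<omega>" if "0 < x" "\<And>n. x < w n" "w \<longlonglongrightarrow> x" for w and x :: real
        using that by (intro continuous_on_tendsto_compose[OF cont])
          (auto intro!: always_eventually less_imp_le intro: less_trans)
      have "0 \<le> ln (t / (t - s))" using st by simp
      then have D: "0 < 1 + ln (t / (t - s)) + \<epsilon> * \<bar>ln t\<bar>"
        using \<open>0 < \<epsilon>\<close> by (auto intro!: add_pos_nonneg)
      have "(\<lambda>n. r \<omega> (u n) (v n)) \<longlonglongrightarrow> r \<omega> s t"
        unfolding r_def using st D
        by (intro tendsto_intros B_lim u v) auto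
      then have "(\<lambda>n. ennreal (r \<omega> (u n) (v n))) \<longlonglongrightarrow> ennreal (r \<omega> s t)"
        by (rule tendsto_ennrealI)
      \<comment> \<open>Eventually \<open>u n < t < v n\<close>, so the approximating pairs are
        correctly ordered.\<close>
      moreover have "\<forall>\<^sub>F n in sequentially. ennreal (r \<omega> (u n) (v n)) \<le> R \<omega>"
        using order_tendstoD(2)[OF u(3) st(2)]
      proof eventually_elim
        case (elim n)
        then have "(u n, v n) \<in> Q"
          using u(1,2)[of n] v(1,2)[of n] st by (auto simp: Q_def)
        then show ?case
          unfolding R_def by (rule SUP_upper2) simp
      qed
      ultimately show ?thesis
        by (rule tendsto_upperbound) simp
    qed
    then have "brownian_modulus B \<epsilon> \<omega> \<le> R \<omega>"
      unfolding brownian_modulus_def by (intro SUP_least) (auto simp: Let_def r_def)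
    moreover have "R \<omega> \<le> brownian_modulus B \<epsilon> \<omega>"
      unfolding R_def brownian_modulus_def r_def Let_def
      by (rule SUP_subset_mono) (auto simp: Q_def)
    ultimately show "R \<omega> = brownian_modulus B \<epsilon> \<omega>" by simp
  qed
  ultimately show ?thesis
    by (rule measurable_completion_AE_eq) simp
qed

end

(* Paths are only almost surely continuous, so the uncountable supremum is a random
   variable on the completed probability space. *)
theorem theorem1:
  fixes M :: "'a measure" and B :: "real \<Rightarrow> 'a \<Rightarrow> real" and \<epsilon> :: real
  assumes "standard_brownian_motion M B"
    and "\<epsilon> > 0"
  shows "admits_exponential_moments (completion M) (\<lambda>\<omega>. (brownian_modulus B \<epsilon> \<omega>)\<^sup>2)"
proof -
  interpret standard_brownian_motion M B by fact
  \<comment> \<open>The reciprocal of the constant in the pathwise bound on the squared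
    modulus.\<close>
  let ?l = "1 / (1352 * (8 + \<epsilon>))"
  have "AE \<omega> in completion M.
      ennreal_exp (ennreal ?l * (brownian_modulus B \<epsilon> \<omega>)\<^sup>2) \<le> ennreal (exp 1) + dyadic_energy B \<epsilon> \<omega>"
    using AE_completion[OF continuous_paths]
    by eventually_elim (rule ennreal_exp_brownian_modulus_le[OF _ \<open>\<epsilon> > 0\<close>])
  then have "(\<integral>\<^sup>+\<omega>. ennreal_exp (ennreal ?l * (brownian_modulus B \<epsilon> \<omega>)\<^sup>2) \<partial>completion M)
      \<le> (\<integral>\<^sup>+\<omega>. ennreal (exp 1) + dyadic_energy B \<epsilon> \<omega> \<partial>completion M)"
    by (rule nn_integral_mono_AE)
  \<comment> \<open>Completion leaves the integral unchanged, and total mass 1 makes the constant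
    contribute exactly \<open>exp 1\<close>.\<close>
  also have "\<dots> = ennreal (exp 1) + (\<integral>\<^sup>+\<omega>. dyadic_energy B \<epsilon> \<omega> \<partial>M)"
    by (simp add: nn_integral_completion nn_integral_add emeasure_space_1)
  also have "\<dots> < \<infinity>"
    using nn_integral_dyadic_energy[OF \<open>\<epsilon> > 0\<close>] by simp
  finally have "(\<integral>\<^sup>+\<omega>. ennreal_exp (ennreal ?l * (brownian_modulus B \<epsilon> \<omega>)\<^sup>2) \<partial>completion M) < \<infinity>" .
  moreover have "0 < ?l" using \<open>\<epsilon> > 0\<close> by simp
  moreover have "(\<lambda>\<omega>. (brownian_modulus B \<epsilon> \<omega>)\<^sup>2) \<in> borel_measurable (completion M)"
    using brownian_modulus_measurable[OF \<open>\<epsilon> > 0\<close>] by (rule borel_measurable_power_ennreal)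
  ultimately show ?thesis
    unfolding admits_exponential_moments_def by (intro conjI exI[of _ ?l])
qed

end
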